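(* Let $G$ be a graph with $n$ vertices. Then $\gamma_{MR}(G)\le n$, and equality holds if and only if $G=\overline{K_n}$ (the edgeless graph on $n$ vertices).
   Context: All graphs are finite and simple. For a vertex $v$ of $G=(V,E)$, $N[v]=\{v\}\cup\{u: uv\in E\}$ is the closed neighborhood, and for $f:V\to\mathbb{R}$ and $S\subseteq V$, $f(S)=\sum_{x\in S}f(x)$. A majority Roman dominating function (MRDF) on $G$ is a function $f:V\to\{-1,1,2\}$ such that (i) $f(N[v])\ge 1$ for at least half of the vertices $v\in V$, and (ii) every vertex $u$ with $f(u)=-1$ is adjacent to at least one vertex $w$ with $f(w)=2$. The weight of $f$ is $f(V)$, and the majority Roman domination number $\gamma_{MR}(G)$ is the minimum weight of an MRDF on $G$. *)

theory Defs
  imports "Graph_Theory.Pair_Digraph"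
begin

text \<open>
  Finite simple graphs are the symmetric, loop-free, finite digraphs of the locale
  \<^locale>\<open>pair_graph\<close>: an edge between u and v is the pair of arcs (u,v), (v,u).
\<close>

definition closed_nbhd :: "'a pair_pre_digraph \<Rightarrow> 'a \<Rightarrow> 'a set" where
  "closed_nbhd G v = {v} \<union> {u. (u, v) \<in> parcs G}"

text \<open>
  Functions on the vertex set are total functions on the vertex type; their values outside
  \<^term>\<open>pverts G\<close> are unconstrained and never used.
\<close>

definition MRDF :: "'a pair_pre_digraph \<Rightarrow> ('a \<Rightarrow> int) \<Rightarrow> bool" where
  "MRDF G f \<longleftrightarrow>
     (\<forall>v \<in> pverts G. f v \<in> {-1, 1, 2}) \<and>
     card (pverts G) \<le> 2 * card {v \<in> pverts G. sum f (closed_nbhd G v) \<ge> 1} \<and>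
     (\<forall>u \<in> pverts G. f u = -1 \<longrightarrow> (\<exists>w. (u, w) \<in> parcs G \<and> f w = 2))"

definition majority_roman_number :: "'a pair_pre_digraph \<Rightarrow> int" where
  "majority_roman_number G = Min {sum f (pverts G) | f. MRDF G f}"

definition edgeless_graph :: "'a set \<Rightarrow> 'a pair_pre_digraph" where
  "edgeless_graph V = \<lparr>pverts = V, parcs = {}\<rparr>"

text \<open>The minimum is taken over a finite nonempty set, so it is a genuine minimum.\<close>

lemma finite_MRDF_weights: "finite {sum f (pverts G) | f. MRDF G f}"
proof (rule finite_subset)
  show "{sum f (pverts G) | f. MRDF G f} \<subseteq> {- int (card (pverts G)) .. 2 * int (card (pverts G))}"
  proof clarify
    fix f assume f: "MRDF G f"
    have bound: "- 1 \<le> f v \<and> f v \<le> 2" if "v \<in> pverts G" for v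
    proof -
      have "f v \<in> {-1, 1, 2}"
        using f that by (simp add: MRDF_def)
      then show ?thesis by auto
    qed
    have "(\<Sum>v\<in>pverts G. - 1) \<le> sum f (pverts G)"
      by (rule sum_mono) (use bound in blast)
    moreover have "sum f (pverts G) \<le> (\<Sum>v\<in>pverts G. 2)"
      by (rule sum_mono) (use bound in blast)
    ultimately show "sum f (pverts G) \<in> {- int (card (pverts G)) .. 2 * int (card (pverts G))}"
      by (simp add: mult.commute)
  qed
qed simp

lemma MRDF_const_1:
  assumes "pair_graph G"
  shows "MRDF G (\<lambda>_. 1)"
proof -
  interpret pair_graph G by (rule assms)
  have "sum (\<lambda>_. 1::int) (closed_nbhd G v) \<ge> 1" if "v \<in> pverts G" for v
  proof -
    have "closed_nbhd G v \<subseteq> pverts G"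
      using that by (auto simp: closed_nbhd_def dest: in_arcsD1)
    then have "finite (closed_nbhd G v)"
      using pair_finite_verts finite_subset by blast
    then have "card (closed_nbhd G v) > 0"
      by (auto simp: card_gt_0_iff closed_nbhd_def)
    then show ?thesis by simp
  qed
  then have "{v \<in> pverts G. sum (\<lambda>_. 1::int) (closed_nbhd G v) \<ge> 1} = pverts G"
    by blast
  then show ?thesis
    by (simp add: MRDF_def)
qed

lemma MRDF_weights_nonempty:
  assumes "pair_graph G"
  shows "{sum f (pverts G) | f. MRDF G f} \<noteq> {}"
  using MRDF_const_1[OF assms] by blast

end

theory Submission
  imports Defs
begin

text \<open>
  Changing the constant function 1 to 2 at u and to -1 at v lowers the weight by one. For an edge
  uv this is an MRDF, in fact with every closed neighbourhood sum positive, unless v has a neighbour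
  other than u that is a leaf; if w is such a leaf, the edge vw can be used in place of uv.
\<close>

context pair_graph
begin

lemma closed_nbhd_subset: "v \<in> pverts G \<Longrightarrow> closed_nbhd G v \<subseteq> pverts G"
  by (auto simp: closed_nbhd_def dest: in_arcsD1)

lemma finite_closed_nbhd: "v \<in> pverts G \<Longrightarrow> finite (closed_nbhd G v)"
  using closed_nbhd_subset pair_finite_verts finite_subset by blast

lemma obtains_arc_without_foreign_leaf:
  assumes "parcs G \<noteq> {}"
  obtains u v where "(u, v) \<in> parcs G"
    and "\<And>x. (x, v) \<in> parcs G \<Longrightarrow> x \<noteq> u \<Longrightarrow> \<exists>y. y \<noteq> v \<and> (y, x) \<in> parcs G"
proof -
  obtain u v where uv: "(u, v) \<in> parcs G"
    using assms by auto
  show thesis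
  proof (cases "\<exists>x. (x, v) \<in> parcs G \<and> x \<noteq> u \<and> (\<forall>y. (y, x) \<in> parcs G \<longrightarrow> y = v)")
    case True
    then obtain x where "(x, v) \<in> parcs G" "\<And>y. (y, x) \<in> parcs G \<Longrightarrow> y = v"
      by blast
    \<comment> \<open>If \<open>x\<close> is a leaf at \<open>v\<close> other than \<open>u\<close>,
      reverse the roles: \<open>v\<close> is to receive 2 and the leaf \<open>x\<close> is to
      receive -1. The only neighbour of \<open>x\<close> is \<open>v\<close>, so the condition on
      further neighbours holds vacuously.\<close>
    then show thesis
      using that[of v x] arcs_symmetric by blast
  next
    case False
    then show thesis
      using that[OF uv] by blast
  qed
qed

lemma MRDF_light_if_arc:
  assumes "parcs G \<noteq> {}"
  obtains f where "MRDF G f" and "sum f (pverts G) < int (card (pverts G))"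
proof -
  obtain u v where uv: "(u, v) \<in> parcs G"
    and no_leaf: "\<And>x. (x, v) \<in> parcs G \<Longrightarrow> x \<noteq> u \<Longrightarrow> \<exists>y. y \<noteq> v \<and> (y, x) \<in> parcs G"
    using obtains_arc_without_foreign_leaf[OF assms] by blast
  have verts: "u \<in> pverts G" "v \<in> pverts G" and neq: "u \<noteq> v"
    using uv by (auto dest: in_arcsD1 in_arcsD2 no_loops')
  define f :: "'a \<Rightarrow> int" where "f = (\<lambda>_. 1)(u := 2, v := -1)"
  have f_ge: "f x \<ge> 1" if "x \<noteq> v" for x
    using that by (simp add: f_def)
  have f_v: "f v = -1" and f_u: "f u = 2"
    using neq by (auto simp: f_def)
  have nbhd: "sum f (closed_nbhd G x) \<ge> 1" if x: "x \<in> pverts G" for x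
  proof -
    \<comment> \<open>Only \<open>v\<close> has a negative value, so enlarging \<open>T\<close>
      within the neighbourhood cannot lower the sum once \<open>v\<close> has been accounted for. It
      therefore suffices to exhibit a small \<open>T\<close> in each case.\<close>
    have bound: "sum f (closed_nbhd G x) \<ge> 1"
      if "T \<subseteq> closed_nbhd G x" "sum f T \<ge> 1" "v \<in> closed_nbhd G x \<longrightarrow> v \<in> T" for T
    proof -
      have "sum f T \<le> sum f (closed_nbhd G x)"
      proof (rule sum_mono2[OF finite_closed_nbhd[OF x] that(1)])
        fix b assume "b \<in> closed_nbhd G x - T"
        then have "b \<noteq> v"
          using that(3) by blast
        from f_ge[OF this] show "0 \<le> f b" by simp
      qed
      with that(2) show ?thesis by simp
    qed
    consider "v \<notin> closed_nbhd G x" | "v \<in> closed_nbhd G x" "u \<in> closed_nbhd G x"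
      | "v \<in> closed_nbhd G x" "u \<notin> closed_nbhd G x" by blast
    then show ?thesis
    proof cases
      case 1
      then have "x \<noteq> v" by (auto simp: closed_nbhd_def)
      then show ?thesis
        using 1 bound[of "{x}"] f_ge by (simp add: closed_nbhd_def)
    next
      \<comment> \<open>The 2 at \<open>u\<close> outweighs the -1 at \<open>v\<close>: the pair
        alone sums to 1.\<close>
      case 2
      then show ?thesis
        using bound[of "{u, v}"] neq f_u f_v by simp
    next
      case 3
      \<comment> \<open>Both \<open>v\<close> and \<open>u\<close> have \<open>u\<close> in their
        closed neighbourhood, so \<open>x\<close> is a neighbour of \<open>v\<close> other than
        \<open>u\<close>. By the choice of the arc it has a second neighbour \<open>y\<close>, and
        the values at \<open>x\<close> and \<open>y\<close>, each at least 1, compensate for the -1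
        at \<open>v\<close>.\<close>
      then have "x \<noteq> v" "x \<noteq> u"
        using uv by (auto simp: closed_nbhd_def)
      with 3 have vx: "(v, x) \<in> parcs G"
        by (auto simp: closed_nbhd_def)
      obtain y where y: "y \<noteq> v" "(y, x) \<in> parcs G"
        using no_leaf[OF arcs_symmetric[OF vx] \<open>x \<noteq> u\<close>] by blast
      have "sum f {x, v, y} = f x + f v + f y"
        using \<open>x \<noteq> v\<close> y no_loops'[OF y(2)] by auto
      then have "sum f {x, v, y} \<ge> 1"
        using f_ge[OF \<open>x \<noteq> v\<close>] f_ge[OF y(1)] f_v by linarith
      then show ?thesis
        using bound[of "{x, v, y}"] vx y by (simp add: closed_nbhd_def)
    qed
  qed
  then have "{x \<in> pverts G. sum f (closed_nbhd G x) \<ge> 1} = pverts G"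
    by blast
  moreover have "\<exists>w. (x, w) \<in> parcs G \<and> f w = 2" if "f x = -1" for x
  proof -
    have "x = v"
      using that f_ge[of x] by force
    then show ?thesis
      using arcs_symmetric[OF uv] f_u by blast
  qed
  ultimately have "MRDF G f"
    by (auto simp: MRDF_def f_def)
  moreover have "sum f (pverts G) = int (card (pverts G)) - 1"
  proof -
    \<comment> \<open>The deviation from the constant 1 lives on \<open>u\<close> and
      \<open>v\<close>, where it is 1 and -2.\<close>
    have "sum (\<lambda>x. f x - 1) (pverts G) = sum (\<lambda>x. f x - 1) {u, v}"
      by (rule sum.mono_neutral_right) (use verts in \<open>auto simp: f_def\<close>)
    also have "\<dots> = -1"
      using neq f_u f_v by simp
    finally show ?thesis
      by (simp add: sum_subtractf)
  qed
  ultimately show thesis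
    using that by simp
qed

end

text \<open>A vertex of value -1 would need a neighbour of value 2. Without arcs there is none, so
  every value is at least 1.\<close>

lemma MRDF_weight_ge_card_if_no_arcs:
  assumes "parcs G = {}" and "MRDF G f"
  shows "int (card (pverts G)) \<le> sum f (pverts G)"
proof -
  have "1 \<le> f v" if "v \<in> pverts G" for v
    proof -
    have "f v \<noteq> -1"
      using assms that by (auto simp: MRDF_def)
    moreover have "f v \<in> {-1, 1, 2}"
      using assms(2) that by (simp add: MRDF_def)
    ultimately show ?thesis by auto
  qed
  then have "(\<Sum>v\<in>pverts G. 1) \<le> sum f (pverts G)"
    by (intro sum_mono)
  then show ?thesis by simp
qed

lemma majority_roman_number_le:
  assumes "MRDF G f"
  shows "majority_roman_number G \<le> sum f (pverts G)"
  unfolding majority_roman_number_def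
  using assms by (intro Min_le finite_MRDF_weights) blast

theorem proposition1:
  fixes G :: "'a pair_pre_digraph" and n :: nat
  assumes "pair_graph G"
    and "card (pverts G) = n"
  shows "majority_roman_number G \<le> int n \<and>
    (majority_roman_number G = int n \<longleftrightarrow> G = edgeless_graph (pverts G))"
proof -
  interpret pair_graph G by (rule assms)
  have le: "majority_roman_number G \<le> int n"
    using majority_roman_number_le[OF MRDF_const_1[OF assms(1)]] assms(2) by simp
  have edgeless: "G = edgeless_graph (pverts G)" if "parcs G = {}"
    using that by (intro pair_pre_digraph.equality) (simp_all add: edgeless_graph_def)
  have "int n \<le> majority_roman_number G" if "parcs G = {}"
    unfolding majority_roman_number_def
    using MRDF_weight_ge_card_if_no_arcs[OF that] assms(2)
    by (intro Min.boundedI finite_MRDF_weights MRDF_weights_nonempty assms(1)) auto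
  \<comment> \<open>Strictness here rules out equality for every graph with an arc.\<close>
  moreover have "majority_roman_number G < int n" if arcs: "parcs G \<noteq> {}"
  proof -
    obtain f where "MRDF G f" "sum f (pverts G) < int n"
      using MRDF_light_if_arc[OF arcs] assms(2) by blast
    then show ?thesis
      using majority_roman_number_le[of G f] by simp
  qed
  moreover have "parcs G = {}" if "G = edgeless_graph (pverts G)"
    by (subst that) (simp add: edgeless_graph_def)
  ultimately show ?thesis
    using le edgeless by (metis order.antisym order.strict_iff_not)
qed

end
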